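(* Let $\mathcal{M} \subset \Delta_{n-1}$ be a discrete linear model. Then for every $p \in \mathcal{M}$ the logarithmic Voronoi cell of $p$ is equal to the log-normal polytope at $p$ (up to points in the boundary of the simplex), i.e. $$\log \mathrm{Vor}_{\mathcal{M}}(p) = \log N_p\mathcal{M} \cap \Delta_{n-1}.$$
   Context: $\Delta_{n-1} = \{u \in \mathbb{R}^n : \sum_{i=1}^n u_i = 1,\ u_i > 0 \text{ for all } i\}$ is the open probability simplex and $\overline{\Delta_{n-1}}$ its closure. Discrete linear model: let $f_1(\theta),\dots,f_n(\theta)$ be nonzero linear polynomials (possibly with constant terms) in $\theta \in \mathbb{R}^d$ such that $\sum_{i=1}^n f_i(\theta) = 1$. Let $\Theta \subset \mathbb{R}^d$ be the set of $\theta$ with $f_i(\theta) > 0$ for all $i$, and suppose $\dim \Theta = d$. The model $\mathcal{M} = f(\Theta) \subseteq \Delta_{n-1}$, where $f=(f_1,\dots,f_n)$, is called a discrete linear model. For $u \in \Delta_{n-1}$ let $\ell_u(q) = \sum_{i=1}^n u_i \log(q_i)$. Write $\Phi(u)=p$ if $p \in \mathcal{M}$ and $p \in \operatorname{argmax}_{q \in \mathcal{M}} \ell_u(q)$. The logarithmic Voronoi cell of $p \in \mathcal{M}$ is $\log \mathrm{Vor}_{\mathcal{M}}(p) = \{u \in \Delta_{n-1} : \Phi(u) = p\}$. $N_p\mathcal{M}$ is the orthogonal complement, for the Euclidean inner product, of the tangent space of $\mathcal{M}$ at $p$. The log-normal space at $p$ is $\log N_p\mathcal{M} = \{u \in \mathbb{R}^n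 : \nabla \ell_u(p) \in N_p\mathcal{M}\}$, where $\nabla \ell_u(p) = (u_1/p_1,\dots,u_n/p_n)$. The log-normal polytope at $p$ is $\log N_p\mathcal{M} \cap \overline{\Delta_{n-1}}$. Saying that a logarithmic Voronoi cell equals its log-normal polytope means equality as sets, excepting the points in the boundary of the simplex. *)

theory Defs
  imports "HOL-Analysis.Analysis"
begin

definition open_simplex :: "(real ^ 'n) set" where
  "open_simplex = {u. (\<Sum>i\<in>UNIV. u $ i) = 1 \<and> (\<forall>i. 0 < u $ i)}"

(* Polynomials of degree at most 1; a constant term is allowed, and so is a vanishing linear part. *)
definition linear_polynomial :: "(real ^ 'd \<Rightarrow> real) \<Rightarrow> bool" where
  "linear_polynomial g \<longleftrightarrow> (\<exists>a b. g = (\<lambda>\<theta>. a \<bullet> \<theta> + b))"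

definition parameter_space :: "(real ^ 'd \<Rightarrow> real ^ 'n) \<Rightarrow> (real ^ 'd) set" where
  "parameter_space f = {\<theta>. \<forall>i. 0 < f \<theta> $ i}"

(* The dimension of the convex set \<Theta> is its affine dimension; the library's dim would be
   the dimension of its linear span. *)
definition discrete_linear_model ::
    "(real ^ 'd \<Rightarrow> real ^ 'n) \<Rightarrow> (real ^ 'n) set \<Rightarrow> bool" where
  "discrete_linear_model f M \<longleftrightarrow>
     (\<forall>i. linear_polynomial (\<lambda>\<theta>. f \<theta> $ i) \<and> (\<lambda>\<theta>. f \<theta> $ i) \<noteq> (\<lambda>\<theta>. 0)) \<and>
     (\<forall>\<theta>. (\<Sum>i\<in>UNIV. f \<theta> $ i) = 1) \<and>
     aff_dim (parameter_space f) = int CARD('d) \<and>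
     M = f ` parameter_space f"

definition loglik :: "real ^ 'n \<Rightarrow> real ^ 'n \<Rightarrow> real" where
  "loglik u q = (\<Sum>i\<in>UNIV. u $ i * ln (q $ i))"

(* The relation \<Phi>(u) = p: the point p lies in M and maximizes the log-likelihood over M. *)
definition is_mle :: "(real ^ 'n) set \<Rightarrow> real ^ 'n \<Rightarrow> real ^ 'n \<Rightarrow> bool" where
  "is_mle M u p \<longleftrightarrow> is_arg_max (loglik u) (\<lambda>q. q \<in> M) p"

definition log_voronoi_cell :: "(real ^ 'n) set \<Rightarrow> real ^ 'n \<Rightarrow> (real ^ 'n) set" where
  "log_voronoi_cell M p = {u \<in> open_simplex. is_mle M u p}"

(* Velocities at p of C1 curves in M through p; this is the tangent space whenever M is an
   embedded submanifold, as a discrete linear model is (relatively open in an affine subspace). *)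
definition tangent_space :: "(real ^ 'n) set \<Rightarrow> real ^ 'n \<Rightarrow> (real ^ 'n) set" where
  "tangent_space M p =
     {v. \<exists>\<gamma> \<epsilon>. 0 < \<epsilon> \<and> \<gamma> C1_differentiable_on {-\<epsilon><..<\<epsilon>} \<and> \<gamma> ` {-\<epsilon><..<\<epsilon>} \<subseteq> M \<and>
           \<gamma> 0 = p \<and> (\<gamma> has_vector_derivative v) (at (0::real))}"

definition normal_space :: "(real ^ 'n) set \<Rightarrow> real ^ 'n \<Rightarrow> (real ^ 'n) set" where
  "normal_space M p = orthogonal_comp (tangent_space M p)"

definition grad_loglik :: "real ^ 'n \<Rightarrow> real ^ 'n \<Rightarrow> real ^ 'n" where
  "grad_loglik u p = (\<chi> i. u $ i / p $ i)"

lemma GDERIV_loglik: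
  fixes u p :: "real ^ 'n"
  assumes "\<And>i. 0 < p $ i"
  shows "GDERIV (loglik u) p :> grad_loglik u p"
proof -
  have "((\<lambda>q. \<Sum>i\<in>UNIV. u $ i * ln (q $ i)) has_derivative
      (\<lambda>h. \<Sum>i\<in>UNIV. u $ i * (h $ i / p $ i))) (at p)"
    using assms
    by (auto intro!: derivative_eq_intros bounded_linear.has_derivative[OF bounded_linear_vec_nth]
        simp: field_simps)
  then show ?thesis
    unfolding gderiv_def loglik_def[abs_def] grad_loglik_def
    by (simp add: inner_vec_def algebra_simps)
qed

definition log_normal_space :: "(real ^ 'n) set \<Rightarrow> real ^ 'n \<Rightarrow> (real ^ 'n) set" where
  "log_normal_space M p = {u. grad_loglik u p \<in> normal_space M p}"

end

theory Submission
  imports Defs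
begin

text \<open>
  The log-likelihood is concave on the positive orthant, and the model is a relatively open piece
  of an affine subspace, so a point of the model maximizes the log-likelihood exactly when it is
  critical along the model.

  That a maximizer is critical is Fermat's rule along each curve in the model through the point
  (\<open>is_mle_imp_log_normal\<close>); it holds for any set at a point with positive coordinates. For the
  converse, affinity enters: the segment between two points of the model extends a little beyond its ends,
  so \<open>q - p\<close> is tangent at \<open>p\<close> for every \<open>q\<close> in the model (\<open>diff_in_tangent_space\<close>). If the
  gradient at \<open>p\<close> is normal, it is therefore orthogonal to every \<open>q - p\<close>, and concavity, in the
  form of the gradient inequality \<open>loglik_le_linearization\<close>, bounds the log-likelihood at \<open>q\<close> by
  its value at \<open>p\<close>.
\<close>

lemma linear_polynomial_along_line:
  assumes "linear_polynomial g"
  shows "g (x + t *\<^sub>R (y - x)) = g x + t * (g y - g x)"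
  using assms by (auto simp: linear_polynomial_def inner_right_distrib inner_diff_right algebra_simps)

lemma discrete_linear_model_pos:
  assumes "discrete_linear_model f M" "q \<in> M"
  shows "0 < q $ i"
  using assms by (auto simp: discrete_linear_model_def parameter_space_def)

lemma discrete_linear_model_line_mem:
  assumes model: "discrete_linear_model f M" and "p \<in> M" "q \<in> M"
    and pos: "\<And>i. 0 < (p + t *\<^sub>R (q - p)) $ i"
  shows "p + t *\<^sub>R (q - p) \<in> M"
proof -
  have lin: "\<And>i. linear_polynomial (\<lambda>\<theta>. f \<theta> $ i)" and M: "M = f ` parameter_space f"
    using model by (auto simp: discrete_linear_model_def)
  obtain \<theta> \<theta>' where \<theta>: "p = f \<theta>" "q = f \<theta>'"
    using \<open>p \<in> M\<close> \<open>q \<in> M\<close> M by blast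
  have eq: "f (\<theta> + t *\<^sub>R (\<theta>' - \<theta>)) = p + t *\<^sub>R (q - p)"
    by (simp add: vec_eq_iff \<theta> linear_polynomial_along_line[OF lin])
  then have "\<theta> + t *\<^sub>R (\<theta>' - \<theta>) \<in> parameter_space f"
    using pos by (simp add: parameter_space_def)
  then show ?thesis
    unfolding M eq[symmetric] by blast
qed

text \<open>
  All coordinates of \<open>p\<close> are positive, so they stay positive on a short piece of the line from \<open>p\<close>
  towards \<open>q\<close> and its backward extension; the tangent space asks for a two-sided curve.
\<close>
lemma diff_in_tangent_space:
  assumes model: "discrete_linear_model f M" and "p \<in> M" "q \<in> M"
  shows "q - p \<in> tangent_space M p"
proof -
  let ?\<gamma> = "\<lambda>t::real. p + t *\<^sub>R (q - p)"
  have "\<forall>\<^sub>F t in nhds 0. 0 < ?\<gamma> t $ i" for i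
  proof (rule order_tendstoD(1))
    have "((\<lambda>t. ?\<gamma> t $ i) \<longlongrightarrow> ?\<gamma> 0 $ i) (nhds 0)"
      by (intro tendsto_intros filterlim_ident)
    then show "((\<lambda>t. ?\<gamma> t $ i) \<longlongrightarrow> p $ i) (nhds 0)"
      by simp
    show "0 < p $ i"
      using discrete_linear_model_pos[OF model \<open>p \<in> M\<close>] .
  qed
  then have "\<forall>\<^sub>F t in nhds 0. \<forall>i. 0 < ?\<gamma> t $ i"
    by (rule eventually_all_finite)
  then obtain \<epsilon> where "0 < \<epsilon>" and pos: "\<And>t. \<bar>t\<bar> < \<epsilon> \<Longrightarrow> \<forall>i. 0 < ?\<gamma> t $ i"
    unfolding eventually_nhds_metric dist_real_def by auto
  have deriv: "(?\<gamma> has_vector_derivative (q - p)) (at t)" for t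
    by (auto intro!: derivative_eq_intros)
  have "?\<gamma> C1_differentiable_on {-\<epsilon><..<\<epsilon>}"
    unfolding C1_differentiable_on_def
    using deriv by (intro exI[of _ "\<lambda>_. q - p"]) simp
  moreover have "?\<gamma> ` {-\<epsilon><..<\<epsilon>} \<subseteq> M"
    using discrete_linear_model_line_mem[OF assms] pos by (force simp: abs_less_iff)
  moreover have "?\<gamma> 0 = p"
    by simp
  ultimately show ?thesis
    unfolding tangent_space_def using \<open>0 < \<epsilon>\<close> deriv by blast
qed

lemma is_mle_imp_log_normal:
  fixes M :: "(real ^ 'n) set"
  assumes pos: "\<And>i. 0 < p $ i" and mle: "is_mle M u p"
  shows "u \<in> log_normal_space M p"
proof -
  have "v \<bullet> grad_loglik u p = 0" if v: "v \<in> tangent_space M p" for v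
  proof -
    obtain \<gamma> \<epsilon> where "0 < \<epsilon>" and \<gamma>M: "\<gamma> ` {-\<epsilon><..<\<epsilon>} \<subseteq> M" and \<gamma>0: "\<gamma> 0 = p"
      and \<gamma>': "(\<gamma> has_vector_derivative v) (at (0::real))"
      using v unfolding tangent_space_def by auto
    have "(loglik u has_derivative (\<lambda>h. h \<bullet> grad_loglik u p)) (at (\<gamma> 0))"
      using GDERIV_loglik[OF pos] by (simp add: gderiv_def \<gamma>0)
    then have "((\<lambda>t. loglik u (\<gamma> t)) has_derivative (\<lambda>t. (t *\<^sub>R v) \<bullet> grad_loglik u p)) (at 0)"
      using has_derivative_compose \<gamma>'[unfolded has_vector_derivative_def] by blast
    then have "((\<lambda>t. loglik u (\<gamma> t)) has_real_derivative v \<bullet> grad_loglik u p) (at 0)"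
      by (simp add: has_field_derivative_def mult_commute_abs)
    moreover have "\<forall>t. \<bar>0 - t\<bar> < \<epsilon> \<longrightarrow> loglik u (\<gamma> t) \<le> loglik u (\<gamma> 0)"
    proof (intro allI impI)
      fix t assume "\<bar>0 - t\<bar> < \<epsilon>"
      then have "\<gamma> t \<in> M"
        using \<gamma>M by (auto simp: abs_less_iff)
      then show "loglik u (\<gamma> t) \<le> loglik u (\<gamma> 0)"
        using mle by (auto simp: is_mle_def is_arg_max_linorder \<gamma>0)
    qed
    ultimately show ?thesis
      using DERIV_local_max \<open>0 < \<epsilon>\<close> by blast
  qed
  then show ?thesis
    by (simp add: log_normal_space_def normal_space_def orthogonal_comp_def orthogonal_def)
qed

text \<open>
  Concavity of the log-likelihood: coordinatewise this is \<open>ln x \<le> x - 1\<close> at \<open>x = q $ i / p $ i\<close>,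
  weighted by \<open>u $ i\<close>.
\<close>
lemma loglik_le_linearization:
  assumes "\<And>i. 0 \<le> u $ i" and p: "\<And>i. 0 < p $ i" and q: "\<And>i. 0 < q $ i"
  shows "loglik u q \<le> loglik u p + (q - p) \<bullet> grad_loglik u p"
proof -
  have "u $ i * ln (q $ i) \<le> u $ i * ln (p $ i) + (q $ i - p $ i) * (u $ i / p $ i)" for i
  proof -
    have "ln (q $ i) - ln (p $ i) \<le> q $ i / p $ i - 1"
      using ln_le_minus_one[of "q $ i / p $ i"] p[of i] q[of i] by (simp add: ln_div)
    then have "u $ i * (ln (q $ i) - ln (p $ i)) \<le> u $ i * (q $ i / p $ i - 1)"
      using assms(1) by (rule mult_left_mono)
    moreover have "u $ i * (q $ i / p $ i - 1) = (q $ i - p $ i) * (u $ i / p $ i)"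
      using p[of i] by (simp add: field_simps)
    ultimately show ?thesis
      by (simp add: right_diff_distrib)
  qed
  then show ?thesis
    unfolding loglik_def grad_loglik_def inner_vec_def
    by (simp add: sum.distrib[symmetric] sum_mono)
qed

theorem theorem9:
  fixes f :: "real ^ 'd \<Rightarrow> real ^ 'n" and M :: "(real ^ 'n) set" and p :: "real ^ 'n"
  assumes "discrete_linear_model f M"
    and "p \<in> M"
  shows "log_voronoi_cell M p = log_normal_space M p \<inter> open_simplex"
proof (intro equalityI subsetI)
  note pos = discrete_linear_model_pos[OF assms(1)]
  fix u assume "u \<in> log_voronoi_cell M p"
  then show "u \<in> log_normal_space M p \<inter> open_simplex"
    using is_mle_imp_log_normal pos[OF assms(2)] by (auto simp: log_voronoi_cell_def)
next
  note pos = discrete_linear_model_pos[OF assms(1)]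
  fix u assume u: "u \<in> log_normal_space M p \<inter> open_simplex"
  have "loglik u q \<le> loglik u p" if "q \<in> M" for q
  proof -
    have "(q - p) \<bullet> grad_loglik u p = 0"
      using u diff_in_tangent_space[OF assms that]
      by (auto simp: log_normal_space_def normal_space_def orthogonal_comp_def orthogonal_def)
    moreover have "0 \<le> u $ i" for i
      using u by (auto simp: open_simplex_def intro: less_imp_le)
    ultimately show ?thesis
      using loglik_le_linearization[of u p q] pos[OF assms(2)] pos[OF that] by simp
  qed
  then show "u \<in> log_voronoi_cell M p"
    using u assms(2) by (auto simp: log_voronoi_cell_def is_mle_def is_arg_max_linorder)
qed

end
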